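(* Let $\Omega$ be a Hausdorff space with Borel $\sigma$-algebra $\mathcal{B}$. Any measurable metric $L:\Omega\times\Omega\to[0,\infty)$ on $\Omega$ belongs to the Cover-Hart class of loss functions on $\Omega$.
   Context: Let $\mathcal{P}$ be the family of the Radon probability measures on the Hausdorff space $(\Omega,\mathcal{B})$, where $\mathcal{B}$ is the Borel $\sigma$-algebra. A function $L:\Omega\times\Omega\to\mathbb{R}$ is called measurable if it is measurable with respect to either argument when the other argument is fixed. (The metric $L$ is not assumed to generate the topology of $\Omega$.) The Cover-Hart class consists of the measurable functions $L:\Omega\times\Omega\to[0,\infty)$ such that $L(y,y)=0$ for all $y\in\Omega$, and $$\alpha \equiv \inf_{y\in\Omega} \mathbb{E}_P\, L(y,Y') \;\leq\; \beta \equiv \mathbb{E}_P\, L(Y,Y') \;\leq\; 2\alpha$$ for all $P\in\mathcal{P}$, where $Y$ and $Y'$ are independent with distribution $P$. Expectations of nonnegative functions may take the value $+\infty$. *)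

theory Defs
  imports "HOL-Probability.Probability"
begin

definition radon_prob :: "'a::t2_space measure \<Rightarrow> bool" where
  "radon_prob P \<longleftrightarrow> prob_space P \<and> sets P = sets borel \<and>
     (\<forall>B\<in>sets borel. emeasure P B = (SUP K\<in>{K. compact K \<and> K \<subseteq> B}. emeasure P K))"

definition separately_measurable :: "('a::t2_space \<Rightarrow> 'a \<Rightarrow> real) \<Rightarrow> bool" where
  "separately_measurable L \<longleftrightarrow>
     (\<forall>y. (\<lambda>x. L x y) \<in> borel_measurable borel) \<and> (\<forall>x. (\<lambda>y. L x y) \<in> borel_measurable borel)"

definition expected_loss_at :: "'a measure \<Rightarrow> ('a \<Rightarrow> 'a \<Rightarrow> real) \<Rightarrow> 'a \<Rightarrow> ennreal" where
  "expected_loss_at P L y = (\<integral>\<^sup>+ y'. ennreal (L y y') \<partial>P)"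

text \<open>The expectation of \<open>L(Y, Y')\<close> for independent \<open>Y\<close>, \<open>Y'\<close> with law \<open>P\<close>. A loss is only assumed
  to be measurable in each argument separately, so it need not be measurable for the product
  \<open>\<sigma>\<close>-algebra, in which case the integral over \<open>P \<Otimes>\<^sub>M P\<close> is not determined by
  \<open>L\<close> and \<open>P\<close> in any canonical way. The expectation is therefore taken as the iterated integral;
  the two lemmas below show that it is the usual expectation as soon as the loss is jointly
  measurable. Should the inner integral fail to be measurable in \<open>y\<close>, the outer one is the lower
  integral, which is the library's convention for the nonnegative integral.\<close>

definition expected_loss :: "'a measure \<Rightarrow> ('a \<Rightarrow> 'a \<Rightarrow> real) \<Rightarrow> ennreal" where
  "expected_loss P L = (\<integral>\<^sup>+ y. expected_loss_at P L y \<partial>P)"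

lemma expected_loss_eq_product:
  assumes "sigma_finite_measure P"
    and "(\<lambda>(y, y'). L y y') \<in> borel_measurable (P \<Otimes>\<^sub>M P)"
  shows "expected_loss P L = (\<integral>\<^sup>+ (y, y'). ennreal (L y y') \<partial>(P \<Otimes>\<^sub>M P))"
proof -
  interpret sigma_finite_measure P by fact
  have "(\<lambda>z. ennreal (case z of (y, y') \<Rightarrow> L y y')) \<in> borel_measurable (P \<Otimes>\<^sub>M P)"
    using assms(2) by measurable
  from nn_integral_fst[OF this] show ?thesis
    by (simp add: expected_loss_def expected_loss_at_def case_prod_unfold)
qed

lemma expected_loss_eq_expectation:
  fixes L :: "'a::t2_space \<Rightarrow> 'a \<Rightarrow> real"
  assumes "prob_space M" and "prob_space.indep_var M borel Y borel Y'"
    and "distr M borel Y = P" and "distr M borel Y' = P"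
    and L: "(\<lambda>(y, y'). L y y') \<in> borel_measurable (borel \<Otimes>\<^sub>M borel)"
  shows "expected_loss P L = (\<integral>\<^sup>+ \<omega>. ennreal (L (Y \<omega>) (Y' \<omega>)) \<partial>M)"
proof -
  interpret prob_space M by fact
  have m: "random_variable borel Y" "random_variable borel Y'"
    and j: "P \<Otimes>\<^sub>M P = distr M (borel \<Otimes>\<^sub>M borel) (\<lambda>\<omega>. (Y \<omega>, Y' \<omega>))"
    using assms(2-4) by (auto simp: indep_var_distribution_eq)
  have "prob_space P" using prob_space_distr[OF m(1)] assms(3) by simp
  then have sf: "sigma_finite_measure P"
    by (simp add: prob_space_def finite_measure_def)
  have "sets P = sets borel" using assms(3) by auto
  then have "sets (P \<Otimes>\<^sub>M P) = sets (borel \<Otimes>\<^sub>M borel)" by (intro sets_pair_measure_cong)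
  then have "(\<lambda>(y, y'). L y y') \<in> borel_measurable (P \<Otimes>\<^sub>M P)"
    using L by (simp cong: measurable_cong_sets)
  then have "expected_loss P L = (\<integral>\<^sup>+ z. ennreal (case z of (y, y') \<Rightarrow> L y y') \<partial>(P \<Otimes>\<^sub>M P))"
    using expected_loss_eq_product[OF sf] by (simp add: case_prod_unfold)
  also have "\<dots> = (\<integral>\<^sup>+ \<omega>. ennreal (L (Y \<omega>) (Y' \<omega>)) \<partial>M)"
    unfolding j using m L by (subst nn_integral_distr) (auto intro!: measurable_Pair)
  finally show ?thesis .
qed

definition cover_hart_class :: "('a::t2_space \<Rightarrow> 'a \<Rightarrow> real) set" where
  "cover_hart_class = {L. separately_measurable L \<and> (\<forall>x y. 0 \<le> L x y) \<and> (\<forall>y. L y y = 0) \<and>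
     (\<forall>P. radon_prob P \<longrightarrow>
        (INF y. expected_loss_at P L y) \<le> expected_loss P L \<and>
        expected_loss P L \<le> 2 * (INF y. expected_loss_at P L y))}"

end

theory Submission imports Defs begin

text \<open>Both inequalities concern the function \<open>e y = E L(y, Y')\<close>, whose mean is \<open>\<beta>\<close> and whose
  infimum is \<open>\<alpha>\<close>. A mean is at least the infimum, which gives \<open>\<alpha> \<le> \<beta>\<close>. For \<open>\<beta> \<le> 2 \<alpha>\<close>, fix
  a point \<open>z\<close> and average the triangle inequality \<open>L(Y, Y') \<le> L(Y, z) + L(z, Y')\<close>: by symmetry of
  the metric both terms on the right have mean \<open>e z\<close>, so \<open>\<beta> \<le> 2 e z\<close>, and \<open>z\<close> is arbitrary.

  The mean of \<open>e\<close> is a lower integral, since \<open>e\<close> is not known to be measurable. Comparisons of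
  integrands survive this because the lower integral is monotone. Additivity does need
  measurability, so the triangle inequality is integrated one variable at a time: in \<open>y'\<close> it
  gives \<open>e y \<le> L y z + e z\<close>, and then this bound is integrated in \<open>y\<close>. Each time the upper bound
  is a section of \<open>L\<close> plus a constant, hence measurable.\<close>

lemma INF_expected_loss_at_le_expected_loss:
  assumes "prob_space P"
  shows "(INF y. expected_loss_at P L y) \<le> expected_loss P L"
proof -
  interpret prob_space P by fact
  have "(INF y. expected_loss_at P L y) = (\<integral>\<^sup>+ _. (INF y. expected_loss_at P L y) \<partial>P)"
    by (simp add: emeasure_space_1)
  also have "\<dots> \<le> expected_loss P L"
    unfolding expected_loss_def by (intro nn_integral_mono INF_lower) simp
  finally show ?thesis .
qed

lemma expected_loss_at_triangle:
  assumes "prob_space P"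
    and meas: "(\<lambda>y'. L z y') \<in> borel_measurable P"
    and nonneg: "\<And>x y. 0 \<le> L x y"
    and triangle: "\<And>x y z. L x z \<le> L x y + L y z"
  shows "expected_loss_at P L y \<le> ennreal (L y z) + expected_loss_at P L z"
proof -
  interpret prob_space P by fact
  have "expected_loss_at P L y \<le> (\<integral>\<^sup>+ y'. ennreal (L y z) + ennreal (L z y') \<partial>P)"
    unfolding expected_loss_at_def
    by (intro nn_integral_mono) (simp flip: ennreal_plus add: nonneg triangle ennreal_leI)
  also have "\<dots> = ennreal (L y z) + expected_loss_at P L z"
    using meas by (simp add: nn_integral_add emeasure_space_1 expected_loss_at_def)
  finally show ?thesis .
qed

lemma expected_loss_le_twice_expected_loss_at:
  assumes "prob_space P"
    and meas: "(\<lambda>y'. L z y') \<in> borel_measurable P"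
    and nonneg: "\<And>x y. 0 \<le> L x y"
    and sym: "\<And>x y. L x y = L y x"
    and triangle: "\<And>x y z. L x z \<le> L x y + L y z"
  shows "expected_loss P L \<le> 2 * expected_loss_at P L z"
proof -
  interpret prob_space P by fact
  have "expected_loss P L \<le> (\<integral>\<^sup>+ y. ennreal (L z y) + expected_loss_at P L z \<partial>P)"
    unfolding expected_loss_def
    using expected_loss_at_triangle[OF assms(1) meas nonneg triangle]
    by (intro nn_integral_mono) (simp add: sym[of z])
  also have "\<dots> = expected_loss_at P L z + expected_loss_at P L z"
    using meas by (simp add: nn_integral_add emeasure_space_1 expected_loss_at_def[of P L z])
  finally show ?thesis by (simp add: mult_2)
qed

theorem theorem2p3:
  fixes L :: "'a::t2_space \<Rightarrow> 'a \<Rightarrow> real"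
  assumes "Metric_space UNIV L" and "separately_measurable L"
  shows "L \<in> cover_hart_class"
proof -
  interpret Metric_space UNIV L by fact
  have "expected_loss P L \<le> 2 * (INF y. expected_loss_at P L y)" if "radon_prob P" for P
  proof -
    have P: "prob_space P" "sets P = sets borel"
      using that by (simp_all add: radon_prob_def)
    have "(\<lambda>y. L z y) \<in> borel_measurable P" for z
      using assms(2) P(2) by (simp add: separately_measurable_def cong: measurable_cong_sets)
    then have "expected_loss P L \<le> 2 * expected_loss_at P L z" for z
      using P(1) by (intro expected_loss_le_twice_expected_loss_at) (auto simp: triangle intro: commute)
    \<comment> \<open>Halving \<open>\<beta>\<close> first turns the bound into a plain lower bound of \<open>e\<close>, so that the
      infimum need not be commuted with the factor 2 in the extended reals.\<close>
    then have "expected_loss P L / 2 \<le> expected_loss_at P L z" for z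
      by (intro divide_le_posI_ennreal) (simp_all add: mult.commute)
    then have "expected_loss P L / 2 \<le> (INF z. expected_loss_at P L z)"
      by (rule INF_greatest)
    then have "2 * (expected_loss P L / 2) \<le> 2 * (INF z. expected_loss_at P L z)"
      by (rule mult_left_mono) simp
    then show ?thesis
      by (simp add: ennreal_times_divide mult.commute[of 2] mult_divide_eq_ennreal)
  qed
  then show ?thesis
    using assms(2) INF_expected_loss_at_le_expected_loss
    by (auto simp: cover_hart_class_def radon_prob_def)
qed

end
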